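(* Let $a,b,n$ be positive integers with $ab\mid n$. Then the one-paired circulant graph $C(n;a,b)$ is isomorphic to the disjoint union of $a$ copies of the one-paired circulant graph $C\left(\frac{n}{a};1,b\right)$, i.e., \[C(n;a,b) \cong \bigcup_{i=1}^a C\left(\frac{n}{a};1,b\right).\]
   Context: For an integer $n\ge 1$ and a set $S\subseteq\{1,\ldots,\lfloor n/2\rfloor\}$, the circulant graph $C_n(S)$ has vertex set $\{0,1,\ldots,n-1\}$, and distinct $x,y$ are adjacent if and only if $|x-y|\in S$ or $n-|x-y|\in S$. For positive integers $a,b$ with $ab\mid n$, the one-paired circulant $C(n;a,b)$ is the circulant graph $C_n(S)$ with $S=\{d\in\{1,\ldots,\lfloor n/2\rfloor\} : a\mid d \text{ and } ab\nmid d\}$. *)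

theory Defs
  imports "Graph_Theory.Graph_Theory"
begin

text \<open>
  A simple undirected graph is rendered as in the library's locale \<open>pair_graph\<close>: a finite loop-free
  digraph whose arc set, a set of ordered pairs, is symmetric.
\<close>

text \<open>
  \<open>C\<^sub>n(S)\<close>, intended for \<open>S \<subseteq> {1..n div 2}\<close>. The subtraction on \<open>nat\<close> below never truncates, because
  \<open>x\<close> and \<open>y\<close> are both less than \<open>n\<close>.
\<close>

definition circulant :: "nat \<Rightarrow> nat set \<Rightarrow> nat pair_pre_digraph" where
  "circulant n S =
    \<lparr> pverts = {0..<n},
      parcs = {(x, y). x \<in> {0..<n} \<and> y \<in> {0..<n} \<and> x \<noteq> y \<and>
        (let d = nat \<bar>int x - int y\<bar> in d \<in> S \<or> n - d \<in> S)} \<rparr>"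

text \<open>\<open>C(n; a, b)\<close>, intended for positive \<open>n\<close>, \<open>a\<close>, \<open>b\<close> with \<open>a * b dvd n\<close>.\<close>

definition one_paired_circulant :: "nat \<Rightarrow> nat \<Rightarrow> nat \<Rightarrow> nat pair_pre_digraph" where
  "one_paired_circulant n a b = circulant n {d \<in> {1..n div 2}. a dvd d \<and> \<not> a * b dvd d}"

text \<open>The copies in a disjoint union are kept apart by tagging each vertex with its index.\<close>

definition disjoint_union ::
  "'i set \<Rightarrow> ('i \<Rightarrow> 'a pair_pre_digraph) \<Rightarrow> ('i \<times> 'a) pair_pre_digraph" where
  "disjoint_union I G =
    \<lparr> pverts = (SIGMA i:I. pverts (G i)),
      parcs = {((i, x), (i, y)) | i x y. i \<in> I \<and> (x, y) \<in> parcs (G i)} \<rparr>"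

text \<open>
  Through \<open>with_proj\<close>, which reads a pair digraph as a general digraph with tail \<open>fst\<close> and head \<open>snd\<close>,
  the library's \<open>digraph_iso\<close> is the existence of a bijection of the vertex sets that preserves and
  reflects adjacency.
\<close>

definition graph_isomorphic :: "'a pair_pre_digraph \<Rightarrow> 'b pair_pre_digraph \<Rightarrow> bool"
  (infix "\<cong>\<^sub>G" 50) where
  "G \<cong>\<^sub>G H \<longleftrightarrow> digraph_iso (with_proj G) (with_proj H)"

lemma pair_graph_circulant: "pair_graph (circulant n S)"
proof
  show "finite (parcs (circulant n S))"
    by (rule finite_subset[of _ "{0..<n} \<times> {0..<n}"]) (auto simp: circulant_def)
  show "symmetric (with_proj (circulant n S))"
    by (auto simp: circulant_def symmetric_def arcs_ends_def arc_to_ends_def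
        intro!: symI simp: Let_def abs_minus_commute image_iff)
qed (auto simp: circulant_def)

lemma pair_graph_one_paired_circulant: "pair_graph (one_paired_circulant n a b)"
  unfolding one_paired_circulant_def by (rule pair_graph_circulant)

lemma pair_graph_disjoint_union:
  assumes "finite I" "\<And>i. i \<in> I \<Longrightarrow> pair_graph (G i)"
  shows "pair_graph (disjoint_union I G)"
proof -
  have wf: "x \<in> pverts (G i)" "y \<in> pverts (G i)" "x \<noteq> y" "(y, x) \<in> parcs (G i)"
    if "i \<in> I" "(x, y) \<in> parcs (G i)" for i x y
  proof -
    interpret pair_graph "G i" using assms that by blast
    show "x \<in> pverts (G i)" "y \<in> pverts (G i)" "x \<noteq> y" "(y, x) \<in> parcs (G i)"
      using that(2) arc_fst_in_verts arc_snd_in_verts no_loops arcs_symmetric by fastforce+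
  qed
  have fin: "finite (pverts (disjoint_union I G))"
    using assms by (auto simp: disjoint_union_def pair_graph_def pair_digraph_def
        pair_fin_digraph_def pair_fin_digraph_axioms_def)
  show ?thesis
  proof
    show "finite (parcs (disjoint_union I G))"
      by (rule finite_subset[OF _ finite_cartesian_product[OF fin fin]])
        (auto simp: disjoint_union_def dest: wf)
    show "symmetric (with_proj (disjoint_union I G))"
      by (auto simp: disjoint_union_def symmetric_def arcs_ends_def arc_to_ends_def
          intro!: symI dest: wf)
    show "finite (pverts (disjoint_union I G))" by (rule fin)
  next
    fix e assume "e \<in> parcs (disjoint_union I G)"
    then obtain i x y where "e = ((i, x), (i, y))" "i \<in> I" "(x, y) \<in> parcs (G i)"
      by (auto simp: disjoint_union_def)
    with wf(1-3)[of i x y]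
    show "fst e \<in> pverts (disjoint_union I G)" "snd e \<in> pverts (disjoint_union I G)"
      "fst e \<noteq> snd e"
      by (simp_all add: disjoint_union_def)
  qed
qed

lemma graph_isomorphic_iff:
  assumes "pair_graph G" "pair_graph H"
  shows "G \<cong>\<^sub>G H \<longleftrightarrow> (\<exists>f. bij_betw f (pverts G) (pverts H) \<and>
    (\<forall>x\<in>pverts G. \<forall>y\<in>pverts G. (x, y) \<in> parcs G \<longleftrightarrow> (f x, f y) \<in> parcs H))"
    (is "?L \<longleftrightarrow> ?R")
proof
  interpret G: pair_graph G by fact
  interpret H: pair_graph H by fact
  {
    assume ?L
    then obtain h where h: "pre_digraph.digraph_isomorphism (with_proj G) h"
      and H: "with_proj H = app_iso h (with_proj G)"
      unfolding graph_isomorphic_def digraph_iso_def by blast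
    let ?f = "iso_verts h"
    from H have v: "pverts H = ?f ` pverts G" and a: "parcs H = iso_arcs h ` parcs G"
      and t: "fst = iso_tail h" and d: "snd = iso_head h"
      by (auto simp: with_proj_def app_iso_def)
    from h have inj: "inj_on ?f (pverts G)"
      and e: "\<forall>p\<in>parcs G. ?f (fst p) = iso_tail h (iso_arcs h p) \<and>
        ?f (snd p) = iso_head h (iso_arcs h p)"
      by (auto simp: pre_digraph.digraph_isomorphism_def)
    have arcs: "iso_arcs h p = (?f (fst p), ?f (snd p))" if "p \<in> parcs G" for p
      using e that t d by (metis prod.collapse)
    have "(x, y) \<in> parcs G \<longleftrightarrow> (?f x, ?f y) \<in> parcs H"
      if "x \<in> pverts G" "y \<in> pverts G" for x y
    proof
      assume "(x, y) \<in> parcs G"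
      then show "(?f x, ?f y) \<in> parcs H" unfolding a using arcs by force
    next
      assume "(?f x, ?f y) \<in> parcs H"
      then obtain p where p: "p \<in> parcs G" "(?f x, ?f y) = (?f (fst p), ?f (snd p))"
        unfolding a using arcs by auto
      then have "fst p \<in> pverts G" "snd p \<in> pverts G"
        using G.arc_fst_in_verts G.arc_snd_in_verts by auto
      with p inj that have "x = fst p" "y = snd p" by (auto dest: inj_onD)
      with p show "(x, y) \<in> parcs G" by simp
    qed
    with inj v show ?R by (auto simp: bij_betw_def)
  }
  {
    assume ?R
    then obtain f where bij: "bij_betw f (pverts G) (pverts H)"
      and adj: "\<And>x y. x \<in> pverts G \<Longrightarrow> y \<in> pverts G \<Longrightarrow>
        (x, y) \<in> parcs G \<longleftrightarrow> (f x, f y) \<in> parcs H" by blast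
    have sub: "x \<in> pverts G" "y \<in> pverts G" if "(x, y) \<in> parcs G" for x y
      using that G.arc_fst_in_verts G.arc_snd_in_verts by fastforce+
    have subH: "x \<in> pverts H" "y \<in> pverts H" if "(x, y) \<in> parcs H" for x y
      using that H.arc_fst_in_verts H.arc_snd_in_verts by fastforce+
    define h where "h = \<lparr> iso_verts = f, iso_arcs = map_prod f f, iso_head = snd, iso_tail = fst \<rparr>"
    have img: "map_prod f f ` parcs G = parcs H"
    proof (intro equalityI subsetI)
      fix p assume "p \<in> map_prod f f ` parcs G"
      then obtain x y where "(x, y) \<in> parcs G" "p = (f x, f y)" by auto
      then show "p \<in> parcs H" using adj[of x y] sub[of x y] by simp
    next
      fix p assume p: "p \<in> parcs H"
      obtain u v where uv: "p = (u, v)" by (cases p)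
      then have "u \<in> f ` pverts G" "v \<in> f ` pverts G"
        using p subH[of u v] bij by (simp_all add: bij_betw_def)
      then obtain x y where xy: "x \<in> pverts G" "y \<in> pverts G" "u = f x" "v = f y" by blast
      then have "(x, y) \<in> parcs G" using adj[of x y] p uv by simp
      then show "p \<in> map_prod f f ` parcs G" using uv xy by force
    qed
    have "inj_on (map_prod f f) (parcs G)"
    proof (rule inj_onI, clarsimp)
      fix x y u v assume "(x, y) \<in> parcs G" "(u, v) \<in> parcs G" "f x = f u" "f y = f v"
      then show "x = u \<and> y = v"
        using sub[of x y] sub[of u v] inj_onD[OF bij_betw_imp_inj_on[OF bij]] by blast
    qed
    then have "pre_digraph.digraph_isomorphism (with_proj G) h"
      using bij G.wf_digraph
      by (auto simp: pre_digraph.digraph_isomorphism_def h_def bij_betw_def)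
    moreover have "with_proj H = app_iso h (with_proj G)"
      using bij img by (auto simp: with_proj_def app_iso_def h_def bij_betw_def)
    ultimately show ?L unfolding graph_isomorphic_def digraph_iso_def by blast
  }
qed

end

theory Submission
  imports Defs
begin

text \<open>
  Because \<open>a\<close> and \<open>a * b\<close> both divide \<open>n\<close>, wrapping around the cycle and the cut-off at \<open>n div 2\<close>
  are invisible to the two divisibility conditions: \<open>x\<close> and \<open>y\<close> are adjacent in \<open>C(n; a, b)\<close> iff
  they agree modulo \<open>a\<close> and differ modulo \<open>a * b\<close> (\<open>one_paired_circulant_adjacent_iff\<close>). So edges
  stay inside the residue classes modulo \<open>a\<close>. Within the class of \<open>r\<close>, write \<open>x = a * q + r\<close>;
  then \<open>x mod (a * b) = a * (q mod b) + r\<close>, so two members of the class are adjacent iff their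
  quotients differ modulo \<open>b\<close>, which is adjacency in \<open>C(n div a; 1, b)\<close>. The isomorphism is
  therefore division with remainder by \<open>a\<close>: the remainder selects the copy and the quotient the
  vertex in it.
\<close>

lemma dvd_nat_abs_diff_iff_mod_eq:
  fixes m x y :: nat
  shows "m dvd nat \<bar>int x - int y\<bar> \<longleftrightarrow> x mod m = y mod m"
proof -
  have "m dvd nat \<bar>int x - int y\<bar> \<longleftrightarrow> int m dvd int x - int y"
    by (simp add: dvd_nat_abs_iff)
  also have "\<dots> \<longleftrightarrow> int x mod int m = int y mod int m"
    by (simp add: mod_eq_dvd_iff)
  also have "\<dots> \<longleftrightarrow> x mod m = y mod m"
    by (simp flip: zmod_int)
  finally show ?thesis .
qed

text \<open>
  Of the two distances \<open>d\<close> and \<open>n - d\<close> around the cycle at least one is at most \<open>n div 2\<close>, and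
  a divisor of \<open>n\<close> divides both or neither, so membership in the connection set depends on \<open>d\<close> only
  through divisibility.
\<close>

lemma one_paired_circulant_adjacent_iff:
  fixes a b n x y :: nat
  assumes "a * b dvd n" "x < n" "y < n"
  shows "(x, y) \<in> parcs (one_paired_circulant n a b) \<longleftrightarrow>
    x mod a = y mod a \<and> x mod (a * b) \<noteq> y mod (a * b)"
proof (cases "x = y")
  case True
  then show ?thesis
    by (simp add: one_paired_circulant_def circulant_def)
next
  case False
  define d where "d = nat \<bar>int x - int y\<bar>"
  have d: "0 < d" "d < n"
    using False assms(2,3) by (auto simp: d_def)
  have reflect: "m dvd n - d \<longleftrightarrow> m dvd d" if "m dvd n" for m
    using that d(2) by (meson dvd_diff_nat dvd_diffD1 less_imp_le)
  have "a dvd n"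
    using assms(1) by (rule dvd_mult_left)
  have half: "d \<in> {1..n div 2} \<or> n - d \<in> {1..n div 2}"
    using d by auto
  define S where "S = {k \<in> {1..n div 2}. a dvd k \<and> \<not> a * b dvd k}"
  have "(x, y) \<in> parcs (one_paired_circulant n a b) \<longleftrightarrow> d \<in> S \<or> n - d \<in> S"
    using False assms(2,3)
    by (simp add: one_paired_circulant_def circulant_def Let_def d_def S_def)
  also have "\<dots> \<longleftrightarrow> a dvd d \<and> \<not> a * b dvd d"
    using half reflect[OF \<open>a dvd n\<close>] reflect[OF assms(1)] unfolding S_def by blast
  finally show ?thesis
    unfolding d_def dvd_nat_abs_diff_iff_mod_eq .
qed

lemma bij_betw_remainder_quotient:
  fixes a n :: nat
  assumes "a > 0" "a dvd n"
  shows "bij_betw (\<lambda>x. (x mod a + 1, x div a)) {0..<n} ({1..a} \<times> {0..<n div a})"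
proof (rule bij_betw_byWitness[where f' = "\<lambda>(i, q). a * q + (i - 1)"])
  show "(\<lambda>x. (x mod a + 1, x div a)) ` {0..<n} \<subseteq> {1..a} \<times> {0..<n div a}"
  proof (rule image_subsetI)
    fix x assume "x \<in> {0..<n}"
    then have "x < n div a * a"
      using assms(2) by simp
    then show "(x mod a + 1, x div a) \<in> {1..a} \<times> {0..<n div a}"
      using assms(1) by (simp add: Suc_le_eq less_mult_imp_div_less)
  qed
  show "(\<lambda>(i, q). a * q + (i - 1)) ` ({1..a} \<times> {0..<n div a}) \<subseteq> {0..<n}"
  proof (rule image_subsetI)
    fix p assume "p \<in> {1..a} \<times> {0..<n div a}"
    then obtain i q where p: "p = (i, q)" and "1 \<le> i" "i \<le> a" "q < n div a"
      by auto
    then have "a * q + (i - 1) < a * Suc q"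
      by simp
    also have "\<dots> \<le> a * (n div a)"
      using \<open>q < n div a\<close> by (intro mult_le_mono2) simp
    finally show "(case p of (i, q) \<Rightarrow> a * q + (i - 1)) \<in> {0..<n}"
      using assms(2) by (simp add: p)
  qed
  let ?f = "\<lambda>x. (x mod a + 1, x div a)" and ?g = "\<lambda>(i, q). a * q + (i - 1)"
  show "\<forall>x\<in>{0..<n}. ?g (?f x) = x"
    by simp
  show "\<forall>p\<in>{1..a} \<times> {0..<n div a}. ?f (?g p) = p"
  proof
    fix p assume "p \<in> {1..a} \<times> {0..<n div a}"
    then obtain i q where p: "p = (i, q)" and "1 \<le> i" "i \<le> a"
      by auto
    define r where "r = i - 1"
    have "i = r + 1" "r < a"
      using \<open>1 \<le> i\<close> \<open>i \<le> a\<close> by (auto simp: r_def)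
    then show "?f (?g p) = p"
      by (simp add: p)
  qed
qed

theorem corollary5p6:
  fixes a b n :: nat
  assumes "a > 0" and "b > 0" and "n > 0"
    and "a * b dvd n"
  shows "one_paired_circulant n a b \<cong>\<^sub>G
    disjoint_union {1..a} (\<lambda>_. one_paired_circulant (n div a) 1 b)"
proof -
  let ?G = "one_paired_circulant n a b"
  let ?C = "one_paired_circulant (n div a) 1 b"
  let ?H = "disjoint_union {1..a} (\<lambda>_. ?C)"
  \<comment> \<open>The copies are numbered from \<open>1\<close>, the remainders from \<open>0\<close>.\<close>
  let ?f = "\<lambda>x. (x mod a + 1, x div a)"
  have "a dvd n"
    using assms(4) by (rule dvd_mult_left)
  have "1 * b dvd n div a"
    using assms(1,4) by (auto elim!: dvdE)
  have verts: "pverts ?G = {0..<n}" "pverts ?H = {1..a} \<times> {0..<n div a}"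
    by (simp_all add: one_paired_circulant_def circulant_def disjoint_union_def)
  have bij: "bij_betw ?f {0..<n} ({1..a} \<times> {0..<n div a})"
    using assms(1) \<open>a dvd n\<close> by (rule bij_betw_remainder_quotient)
  have "(x, y) \<in> parcs ?G \<longleftrightarrow> (?f x, ?f y) \<in> parcs ?H" if "x < n" "y < n" for x y
  proof -
    have "?f x \<in> {1..a} \<times> {0..<n div a}" "?f y \<in> {1..a} \<times> {0..<n div a}"
      using that bij_betwE[OF bij] by auto
    then have quot: "x div a < n div a" "y div a < n div a"
      by auto
    have "(x, y) \<in> parcs ?G \<longleftrightarrow> x mod a = y mod a \<and> x div a mod b \<noteq> y div a mod b"
      unfolding one_paired_circulant_adjacent_iff[OF assms(4) that]
      using assms(1) by (auto simp: mod_mult2_eq)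
    also have "\<dots> \<longleftrightarrow> x mod a = y mod a \<and> (x div a, y div a) \<in> parcs ?C"
      unfolding one_paired_circulant_adjacent_iff[OF \<open>1 * b dvd n div a\<close> quot] by simp
    also have "\<dots> \<longleftrightarrow> (?f x, ?f y) \<in> parcs ?H"
      using assms(1) by (auto simp: disjoint_union_def Suc_le_eq)
    finally show ?thesis .
  qed
  moreover have "pair_graph ?G" "pair_graph ?H"
    by (simp_all add: pair_graph_one_paired_circulant pair_graph_disjoint_union)
  ultimately show ?thesis
    using bij unfolding verts graph_isomorphic_iff[OF \<open>pair_graph ?G\<close> \<open>pair_graph ?H\<close>]
    by (intro exI[of _ ?f]) auto
qed

end
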